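(* Let $d\ge 2$, let $\mathbf{X}=(X_1,\ldots,X_d)$ be a $d$-dimensional random vector whose marginals are uniform on $[0,1]$, let $C$ be its associated $d$-copula, and let $\alpha=(\alpha_1,\ldots,\alpha_d)\in\mathbb{R}^d$ with $\alpha_i\in\{-1,1\}$ for all $i=1,\ldots,d$. Let $I\subseteq\{1,\ldots,d\}$ be such that $\alpha_i=-1$ if $i\in I$ and $\alpha_i=1$ if $i\in J=\{1,\ldots,d\}\setminus I$. Then $$\varphi_d^\alpha(C)=\frac{2(d+1)}{d-1}\sum_{S\subseteq J}(-1)^{|S|}\,\frac{|I|+|S|-1}{2(|I|+|S|+1)}\,\varphi^-_{\mathbf{X}_{I\cup S}},$$ where the terms with $|I\cup S|\le 1$ are taken to be $0$.
   Context: The copula $C$ of $\mathbf{X}$ (uniform $[0,1]$ marginals) is its joint distribution function on $[0,1]^d$. The directional footrule-coefficient of $C$ in the direction $\alpha\in\{-1,1\}^d$ is $$\varphi_d^\alpha(C)=\frac{2(d+1)}{d-1}\int_0^1\left(\mathbb{P}[\alpha_1X_1>\alpha_1u,\ldots,\alpha_dX_d>\alpha_du]-\prod_{i=1}^d\mathbb{P}[\alpha_iX_i>\alpha_iu]\right)\mathrm{d}u.$$ For $K\subseteq\{1,\ldots,d\}$, $\mathbf{X}_K$ denotes the random vector with components $X_i$, $i\in K$. For $k=|K|\ge 2$, $\varphi^-_{\mathbf{X}_K}$ is the coefficient $\varphi_k^-$ (the downward diagonal dependence index) of $\mathbf{X}_K$: $$\varphi^-_{\mathbf{X}_K}=\frac{2(k+1)}{k-1}\int_0^1\mathbb{P}[X_i\le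 u\text{ for all }i\in K]\,\mathrm{d}u-\frac{2}{k-1}.$$ *)

theory Defs
  imports "HOL-Probability.Probability"
begin

text \<open>A \<open>d\<close>-dimensional random vector is a family \<open>X i\<close> of real random variables, of which only
  the components \<open>i \<in> {1..d}\<close> matter.\<close>

definition uniform_marginals :: "'a measure \<Rightarrow> nat \<Rightarrow> (nat \<Rightarrow> 'a \<Rightarrow> real) \<Rightarrow> bool" where
  "uniform_marginals M d X \<longleftrightarrow>
     (\<forall>i\<in>{1..d}. X i \<in> borel_measurable M \<and> distr M borel (X i) = uniform_measure lborel {0..1})"

text \<open>Since the marginals are uniform, the copula is the joint distribution function itself.
  It is a function on \<open>[0,1]^d\<close>; its values elsewhere are left unconstrained.\<close>

definition has_copula ::
    "'a measure \<Rightarrow> nat \<Rightarrow> (nat \<Rightarrow> 'a \<Rightarrow> real) \<Rightarrow> ((nat \<Rightarrow> real) \<Rightarrow> real) \<Rightarrow> bool" where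
  "has_copula M d X C \<longleftrightarrow> uniform_marginals M d X \<and>
     (\<forall>u \<in> {1..d} \<rightarrow>\<^sub>E {0..1}. C u = measure M {\<omega> \<in> space M. \<forall>i\<in>{1..d}. X i \<omega> \<le> u i})"

text \<open>The probability law on \<open>\<real>^d\<close> with copula \<open>C\<close>. Lemma \<open>copula_law_eq\<close> below shows
  that it is unique, and equal to the law of any random vector with copula \<open>C\<close>.\<close>

definition copula_law :: "nat \<Rightarrow> ((nat \<Rightarrow> real) \<Rightarrow> real) \<Rightarrow> (nat \<Rightarrow> real) measure" where
  "copula_law d C = (THE \<mu>. prob_space \<mu> \<and> sets \<mu> = sets (PiM {1..d} (\<lambda>_. borel)) \<and>
     has_copula \<mu> d (\<lambda>i x. x i) C)"

definition dir_footrule :: "nat \<Rightarrow> (nat \<Rightarrow> real) \<Rightarrow> ((nat \<Rightarrow> real) \<Rightarrow> real) \<Rightarrow> real" where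
  "dir_footrule d \<alpha> C = (let P = copula_law d C in
     2 * (real d + 1) / (real d - 1) *
     (LBINT u:{0..1}.
        measure P {x \<in> space P. \<forall>i\<in>{1..d}. \<alpha> i * x i > \<alpha> i * u}
        - (\<Prod>i=1..d. measure P {x \<in> space P. \<alpha> i * x i > \<alpha> i * u})))"

text \<open>The downward diagonal dependence index of the subvector \<open>X\<^sub>K\<close>; meaningful for
  \<open>card K \<ge> 2\<close>.\<close>

definition phi_minus :: "'a measure \<Rightarrow> (nat \<Rightarrow> 'a \<Rightarrow> real) \<Rightarrow> nat set \<Rightarrow> real" where
  "phi_minus M X K =
     2 * (real (card K) + 1) / (real (card K) - 1) *
       (LBINT u:{0..1}. measure M {\<omega> \<in> space M. \<forall>i\<in>K. X i \<omega> \<le> u})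
     - 2 / (real (card K) - 1)"

lemma AE_uniform_marginals:
  assumes "prob_space M" "uniform_marginals M d X" "i \<in> {1..d}"
  shows "AE \<omega> in M. X i \<omega> \<in> {0..1}"
proof -
  have m: "X i \<in> borel_measurable M" and eq: "distr M borel (X i) = uniform_measure lborel {0..1}"
    using assms by (auto simp: uniform_marginals_def)
  have "AE x in distr M borel (X i). x \<in> {0..1}"
    unfolding eq by (intro AE_uniform_measureI) auto
  moreover have "{x \<in> space borel. x \<in> {0..1::real}} \<in> sets borel" by measurable
  ultimately show ?thesis using AE_distr_iff[OF m, of "\<lambda>x. x \<in> {0..1}"] by simp
qed

lemma has_copula_real:
  assumes "prob_space M" "has_copula M d X C"
  shows "measure M {\<omega> \<in> space M. \<forall>i\<in>{1..d}. X i \<omega> \<le> a i} =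
    (if \<forall>i\<in>{1..d}. a i \<ge> 0 then C (\<lambda>i\<in>{1..d}. min 1 (a i)) else 0)"
proof -
  interpret prob_space M by fact
  have um: "uniform_marginals M d X" using assms by (simp add: has_copula_def)
  have [measurable]: "i \<in> {1..d} \<Longrightarrow> X i \<in> borel_measurable M" for i
    using um by (auto simp: uniform_marginals_def)
  have ae: "AE \<omega> in M. \<forall>i\<in>{1..d}. X i \<omega> \<in> {0..1}"
    by (rule AE_finite_allI) (use AE_uniform_marginals[OF assms(1) um] in simp_all)
  show ?thesis
  proof (cases "\<forall>i\<in>{1..d}. a i \<ge> 0")
    case True
    have "measure M {\<omega> \<in> space M. \<forall>i\<in>{1..d}. X i \<omega> \<le> a i} =
      measure M {\<omega> \<in> space M. \<forall>i\<in>{1..d}. X i \<omega> \<le> (\<lambda>i\<in>{1..d}. min 1 (a i)) i}"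
    proof (intro finite_measure_eq_AE)
      show "AE \<omega> in M. (\<omega> \<in> {\<omega> \<in> space M. \<forall>i\<in>{1..d}. X i \<omega> \<le> a i}) =
        (\<omega> \<in> {\<omega> \<in> space M. \<forall>i\<in>{1..d}. X i \<omega> \<le> (\<lambda>i\<in>{1..d}. min 1 (a i)) i})"
        using ae by eventually_elim simp
    qed measurable
    also have "\<dots> = C (\<lambda>i\<in>{1..d}. min 1 (a i))"
    proof -
      have "(\<lambda>i\<in>{1..d}. min 1 (a i)) \<in> {1..d} \<rightarrow>\<^sub>E {0..1}" using True by auto
      with assms(2) show ?thesis unfolding has_copula_def by (blast intro: sym)
    qed
    finally show ?thesis using True by simp
  next
    case False
    then obtain j where j: "j \<in> {1..d}" "a j < 0" by force
    have "measure M {\<omega> \<in> space M. \<forall>i\<in>{1..d}. X i \<omega> \<le> a i} = measure M {}"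
    proof (intro finite_measure_eq_AE)
      show "AE \<omega> in M. (\<omega> \<in> {\<omega> \<in> space M. \<forall>i\<in>{1..d}. X i \<omega> \<le> a i}) = (\<omega> \<in> {})"
        using ae
      proof eventually_elim
        case (elim \<omega>)
        then have "\<not> X j \<omega> \<le> a j" using j by (auto dest: bspec[of _ _ j])
        then show ?case using j(1) by blast
      qed
    qed measurable
    then show ?thesis by (simp only: measure_empty if_not_P[OF False])
  qed
qed

lemma sets_PiM_atMost:
  "sets (PiM {1..d::nat} (\<lambda>_. borel :: real measure)) =
   sigma_sets ({1..d} \<rightarrow>\<^sub>E UNIV) (range (\<lambda>a :: nat \<Rightarrow> real. ({1..d} \<rightarrow>\<^sub>E UNIV) \<inter> {x. \<forall>i\<in>{1..d}. x i \<le> a i}))"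
  (is "sets ?P = sigma_sets ?S ?E")
proof (rule antisym)
  have sub: "?E \<subseteq> Pow ?S" by blast
  have id: "(\<lambda>x. x) \<in> sigma ?S ?E \<rightarrow>\<^sub>M ?P"
  proof (rule measurable_PiM_single')
    fix i assume i: "i \<in> {1..d}"
    show "(\<lambda>x. x i) \<in> borel_measurable (sigma ?S ?E)"
      unfolding borel_measurable_iff_le
    proof
      fix a :: real
      have "{x \<in> ?S. x i \<le> a} =
        (\<Union>n::nat. ?S \<inter> {x. \<forall>j\<in>{1..d}. x j \<le> (if j = i then a else real n)})"
      proof (intro set_eqI iffI)
        fix x assume x: "x \<in> {x \<in> ?S. x i \<le> a}"
        obtain n :: nat where n: "(\<Sum>j\<in>{1..d}. \<bar>x j\<bar>) \<le> real n" using real_arch_simple by blast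
        have "x j \<le> real n" if "j \<in> {1..d}" for j
          using member_le_sum[of j "{1..d}" "\<lambda>j. \<bar>x j\<bar>"] n that by auto
        then show "x \<in> (\<Union>n::nat. ?S \<inter> {x. \<forall>j\<in>{1..d}. x j \<le> (if j = i then a else real n)})"
          using x by (intro UN_I[of n]) auto
      next
        fix x assume "x \<in> (\<Union>n::nat. ?S \<inter> {x. \<forall>j\<in>{1..d}. x j \<le> (if j = i then a else real n)})"
        then obtain n :: nat where n: "x \<in> ?S" "\<forall>j\<in>{1..d}. x j \<le> (if j = i then a else real n)"
          by blast
        then show "x \<in> {x \<in> ?S. x i \<le> a}" using bspec[OF n(2) i] by simp
      qed
      also have "\<dots> \<in> sigma_sets ?S ?E"
        by (intro sigma_sets.Union sigma_sets.Basic)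
          (rule image_eqI[OF _ UNIV_I], rule refl)
      finally show "{x \<in> space (sigma ?S ?E). x i \<le> a} \<in> sets (sigma ?S ?E)"
        by (simp add: space_measure_of_conv sets_measure_of_conv image_subset_iff)
    qed
  qed (auto simp: space_measure_of_conv)
  show "sets ?P \<subseteq> sigma_sets ?S ?E"
  proof
    fix A assume A: "A \<in> sets ?P"
    have "A \<subseteq> ?S" using sets.sets_into_space[OF A] by (simp add: space_PiM)
    moreover have "(\<lambda>x. x) -` A \<inter> ?S \<in> sigma_sets ?S ?E"
      using measurable_sets[OF id A] unfolding space_measure_of[OF sub] sets_measure_of[OF sub] .
    ultimately show "A \<in> sigma_sets ?S ?E" by (simp only: vimage_ident Int_absorb2)
  qed
next
  have "?S \<inter> {x. \<forall>i\<in>{1..d}. x i \<le> a i} \<in> sets ?P" for a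
  proof -
    have "{x \<in> space ?P. \<forall>i\<in>{1..d}. x i \<le> a i} \<in> sets ?P" by measurable
    then show ?thesis by (simp add: space_PiM Int_def)
  qed
  then have "?E \<subseteq> sets ?P" by (rule image_subsetI)
  then show "sigma_sets ?S ?E \<subseteq> sets ?P"
    using sets.sigma_sets_subset[of ?E ?P] unfolding space_PiM space_borel by blast
qed

lemma copula_law_unique:
  assumes "prob_space \<mu>" "sets \<mu> = sets (PiM {1..d} (\<lambda>_. borel))" "has_copula \<mu> d (\<lambda>i x. x i) C"
    and "prob_space \<nu>" "sets \<nu> = sets (PiM {1..d} (\<lambda>_. borel))" "has_copula \<nu> d (\<lambda>i x. x i) C"
  shows "\<mu> = \<nu>"
proof -
  interpret m: prob_space \<mu> by fact
  interpret n: prob_space \<nu> by fact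
  let ?S = "{1..d} \<rightarrow>\<^sub>E (UNIV :: real set)"
  let ?B = "\<lambda>a :: nat \<Rightarrow> real. ?S \<inter> {x. \<forall>i\<in>{1..d}. x i \<le> a i}"
  have sp: "space \<mu> = ?S" "space \<nu> = ?S"
    using sets_eq_imp_space_eq[OF assms(2)] sets_eq_imp_space_eq[OF assms(5)] by (auto simp: space_PiM)
  show ?thesis
  proof (rule measure_eqI_generator_eq[where \<Omega>="?S" and E="range ?B" and A="\<lambda>n. ?B (\<lambda>_. real n)"])
    show "Int_stable (range ?B)"
    proof (rule Int_stableI)
      fix A A' assume "A \<in> range ?B" "A' \<in> range ?B"
      then obtain a b where "A = ?B a" "A' = ?B b" by blast
      then have "A \<inter> A' = ?B (\<lambda>i. min (a i) (b i))" by auto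
      then show "A \<inter> A' \<in> range ?B" by (rule range_eqI[where x="\<lambda>i. min (a i) (b i)"])
    qed
  next
    fix A assume "A \<in> range ?B"
    then obtain a where a: "A = ?B a" by blast
    have "A = {x \<in> space \<mu>. \<forall>i\<in>{1..d}. x i \<le> a i}" "A = {x \<in> space \<nu>. \<forall>i\<in>{1..d}. x i \<le> a i}"
      unfolding a sp by auto
    then show "emeasure \<mu> A = emeasure \<nu> A"
      using has_copula_real[OF assms(1,3), of a] has_copula_real[OF assms(4,6), of a]
      by (simp add: m.emeasure_eq_measure n.emeasure_eq_measure)
  next
    show "(\<Union>n. ?B (\<lambda>_. real n)) = ?S"
    proof (intro set_eqI iffI)
      fix x assume x: "x \<in> ?S"
      obtain n :: nat where n: "(\<Sum>j\<in>{1..d}. \<bar>x j\<bar>) \<le> real n" using real_arch_simple by blast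
      have "x j \<le> real n" if "j \<in> {1..d}" for j
        using member_le_sum[of j "{1..d}" "\<lambda>j. \<bar>x j\<bar>"] n that by auto
      then show "x \<in> (\<Union>n. ?B (\<lambda>_. real n))" using x by (intro UN_I[of n]) auto
    qed auto
  next
    show "sets \<mu> = sigma_sets ?S (range ?B)" "sets \<nu> = sigma_sets ?S (range ?B)"
      unfolding assms(2,5) by (rule sets_PiM_atMost)+
  next
    show "range ?B \<subseteq> Pow ?S" by blast
  next
    show "range (\<lambda>n. ?B (\<lambda>_. real n)) \<subseteq> range ?B" by (rule image_subsetI) (rule rangeI)
  qed simp
qed

lemma copula_law_eq:
  assumes "prob_space M" "has_copula M d X C"
  shows "copula_law d C = distr M (PiM {1..d} (\<lambda>_. borel)) (\<lambda>\<omega>. \<lambda>i\<in>{1..d}. X i \<omega>)"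
    (is "_ = ?D")
proof -
  interpret prob_space M by fact
  have [measurable]: "i \<in> {1..d} \<Longrightarrow> X i \<in> borel_measurable M" for i
    using assms by (auto simp: has_copula_def uniform_marginals_def)
  have T: "(\<lambda>\<omega>. \<lambda>i\<in>{1..d}. X i \<omega>) \<in> M \<rightarrow>\<^sub>M PiM {1..d} (\<lambda>_. borel)"
    by (intro measurable_restrict) auto
  have p: "prob_space ?D" by (rule prob_space_distr[OF T])
  have "has_copula ?D d (\<lambda>i x. x i) C"
    unfolding has_copula_def uniform_marginals_def
  proof (intro conjI ballI)
    fix i assume i: "i \<in> {1..d}"
    then show "(\<lambda>x. x i) \<in> borel_measurable ?D" by simp
    show "distr ?D borel (\<lambda>x. x i) = uniform_measure lborel {0..1}"
      using i assms T
      by (subst distr_distr) (auto simp: o_def has_copula_def uniform_marginals_def)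
  next
    fix u :: "nat \<Rightarrow> real" assume u: "u \<in> {1..d} \<rightarrow>\<^sub>E {0..1}"
    have "{x \<in> space (PiM {1..d} (\<lambda>_. borel)). \<forall>i\<in>{1..d}. x i \<le> u i} \<in> sets (PiM {1..d} (\<lambda>_. borel))"
      by measurable
    then show "C u = measure ?D {x \<in> space ?D. \<forall>i\<in>{1..d}. x i \<le> u i}"
      using assms(2) u T
      by (auto simp: has_copula_def measure_distr space_PiM intro!: arg_cong[where f="measure M"])
  qed
  with p show ?thesis
    unfolding copula_law_def by (intro the_equality) (auto intro: copula_law_unique)
qed

end

theory Submission
  imports Defs
begin

text \<open>Write \<open>G\<^sub>K(u)\<close> for the probability that \<open>X\<^sub>i \<le> u\<close> for all \<open>i \<in> K\<close>. Uniform marginals have no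
  atoms, so strict and weak inequalities are interchangeable, and inclusion-exclusion over the
  coordinates in \<open>J\<close> expresses the probability of the directional orthant as
  \<open>\<Sum>\<^bsub>S \<subseteq> J\<^esub> (-1)\<^sup>|\<^sup>S\<^sup>| G\<^bsub>I\<union>S\<^esub>(u)\<close> (lemma \<open>prob_orthant\<close>). The product of the marginal
  probabilities is the same quantity for independent uniform coordinates: it is
  \<open>u\<^sup>|\<^sup>I\<^sup>| (1 - u)\<^sup>|\<^sup>J\<^sup>|\<close>, and its expansion has the same signs with \<open>u\<^sup>k\<close>, \<open>k = |I \<union> S|\<close>, in place of
  \<open>G\<^bsub>I\<union>S\<^esub>(u)\<close>. Hence the integrand of the directional coefficient is a signed sum of
  \<open>G\<^bsub>I\<union>S\<^esub>(u) - u\<^sup>k\<close>.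

  The downward index is a rescaling of the integral of exactly this difference
  (lemma \<open>integral_diagonal_minus_power\<close>): its additive constant comes from
  \<open>\<integral> u\<^sup>k du = 1 / (k + 1)\<close>. For \<open>k \<le> 1\<close>, where the index is not meaningful, \<open>G\<^bsub>I\<union>S\<^esub>(u) = u\<^sup>k\<close>
  identically, so these summands vanish.\<close>

section \<open>Inclusion-exclusion for orthant probabilities\<close>

text \<open>The indicator of the event on the left is the product of the indicators of the \<open>P i\<close> over
  \<open>I\<close> and of their complements over \<open>J\<close>. Multiplying out the factors \<open>1 - 1\<^bsub>P j\<^esub>\<close> and taking
  expectations gives the formula. Working with predicates keeps the case \<open>I \<union> S = {}\<close> uniform,
  where the summand is the probability of the whole space.\<close>

lemma (in prob_space) prob_inclusion_exclusion:
  assumes "finite I" "finite J"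
    and ev: "\<And>i. i \<in> I \<union> J \<Longrightarrow> {\<omega> \<in> space M. P i \<omega>} \<in> events"
  shows "prob {\<omega> \<in> space M. (\<forall>i\<in>I. P i \<omega>) \<and> (\<forall>j\<in>J. \<not> P j \<omega>)} =
    (\<Sum>S\<in>Pow J. (-1) ^ card S * prob {\<omega> \<in> space M. \<forall>i\<in>I \<union> S. P i \<omega>})"
proof -
  have of_bool_ball: "of_bool (\<forall>i\<in>K. Q i) = (\<Prod>i\<in>K. of_bool (Q i) :: real)"
    if "finite K" for K :: "'b set" and Q
    using that by induction auto
  have expand: "indicator {\<omega> \<in> space M. (\<forall>i\<in>I. P i \<omega>) \<and> (\<forall>j\<in>J. \<not> P j \<omega>)} \<omega> =
    (\<Sum>S\<in>Pow J. (-1) ^ card S * indicator {\<omega> \<in> space M. \<forall>i\<in>I \<union> S. P i \<omega>} \<omega> :: real)"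
    if "\<omega> \<in> space M" for \<omega>
  proof -
    have "indicator {\<omega> \<in> space M. (\<forall>i\<in>I. P i \<omega>) \<and> (\<forall>j\<in>J. \<not> P j \<omega>)} \<omega> =
      of_bool (\<forall>i\<in>I. P i \<omega>) * (\<Prod>j\<in>J. 1 - of_bool (P j \<omega>) :: real)"
      using that of_bool_ball[OF \<open>finite J\<close>, of "\<lambda>j. \<not> P j \<omega>"]
      by (simp add: indicator_def of_bool_not_iff of_bool_conj)
    also have "\<dots> = (\<Sum>S\<in>Pow J. (-1) ^ card S *
        (of_bool (\<forall>i\<in>I. P i \<omega>) * (\<Prod>j\<in>S. of_bool (P j \<omega>))))"
      by (simp add: prod_diff_conv_sum[OF \<open>finite J\<close>] sum_distrib_left mult_ac)
    also have "\<dots> = (\<Sum>S\<in>Pow J. (-1) ^ card S * indicator {\<omega> \<in> space M. \<forall>i\<in>I \<union> S. P i \<omega>} \<omega>)"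
    proof (intro sum.cong refl)
      fix S assume "S \<in> Pow J"
      then have "finite S" using \<open>finite J\<close> finite_subset by auto
      have "of_bool (\<forall>i\<in>I. P i \<omega>) * of_bool (\<forall>j\<in>S. P j \<omega>) =
        (indicator {\<omega> \<in> space M. \<forall>i\<in>I \<union> S. P i \<omega>} \<omega> :: real)"
        using that by (auto simp: indicator_def)
      then show "(-1) ^ card S * (of_bool (\<forall>i\<in>I. P i \<omega>) * (\<Prod>j\<in>S. of_bool (P j \<omega>))) =
        (-1) ^ card S * (indicator {\<omega> \<in> space M. \<forall>i\<in>I \<union> S. P i \<omega>} \<omega> :: real)"
        using of_bool_ball[OF \<open>finite S\<close>, of "\<lambda>j. P j \<omega>"] by simp
    qed
    finally show ?thesis .
  qed
  have ball_ev: "{\<omega> \<in> space M. \<forall>i\<in>I \<union> S. P i \<omega>} \<in> events" if "S \<in> Pow J" for S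
    using that assms ev by (intro sets.sets_Collect_finite_All) (auto intro: finite_subset)
  have "{\<omega> \<in> space M. (\<forall>i\<in>I. P i \<omega>) \<and> (\<forall>j\<in>J. \<not> P j \<omega>)} \<in> events"
    using assms by (intro sets.sets_Collect_conj sets.sets_Collect_finite_All sets.sets_Collect_neg) auto
  then have "prob {\<omega> \<in> space M. (\<forall>i\<in>I. P i \<omega>) \<and> (\<forall>j\<in>J. \<not> P j \<omega>)} =
    (\<integral>\<omega>. indicator {\<omega> \<in> space M. (\<forall>i\<in>I. P i \<omega>) \<and> (\<forall>j\<in>J. \<not> P j \<omega>)} \<omega> \<partial>M)"
    by simp
  also have "\<dots> = (\<integral>\<omega>. (\<Sum>S\<in>Pow J. (-1) ^ card S *
      indicator {\<omega> \<in> space M. \<forall>i\<in>I \<union> S. P i \<omega>} \<omega>) \<partial>M)"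
    by (intro Bochner_Integration.integral_cong refl expand)
  also have "\<dots> = (\<Sum>S\<in>Pow J. (\<integral>\<omega>. (-1) ^ card S *
      indicator {\<omega> \<in> space M. \<forall>i\<in>I \<union> S. P i \<omega>} \<omega> \<partial>M))"
    using ball_ev by (intro Bochner_Integration.integral_sum integrable_mult_right) (simp add: less_top[symmetric])
  also have "\<dots> = (\<Sum>S\<in>Pow J. (-1) ^ card S * prob {\<omega> \<in> space M. \<forall>i\<in>I \<union> S. P i \<omega>})"
    using ball_ev by (intro sum.cong refl) simp
  finally show ?thesis .
qed

text \<open>The first three parts evaluate the factors of the marginal product; the last is the absence
  of atoms, which lets strict inequalities be replaced by weak ones.\<close>

lemma prob_uniform_marginal:
  assumes "prob_space M" "uniform_marginals M d X" "i \<in> {1..d}" and u: "u \<in> {0..1}"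
  shows "measure M {\<omega> \<in> space M. X i \<omega> \<le> u} = u"
    and "measure M {\<omega> \<in> space M. X i \<omega> < u} = u"
    and "measure M {\<omega> \<in> space M. X i \<omega> > u} = 1 - u"
    and "AE \<omega> in M. X i \<omega> \<noteq> u"
proof -
  interpret prob_space M by fact
  have m [measurable]: "X i \<in> borel_measurable M"
    and eq: "distr M borel (X i) = uniform_measure lborel {0..1}"
    using assms by (auto simp: uniform_marginals_def)
  have law: "measure M {\<omega> \<in> space M. X i \<omega> \<in> A} = measure lborel ({0..1} \<inter> A)"
    if "A \<in> sets borel" for A
  proof -
    have "measure M {\<omega> \<in> space M. X i \<omega> \<in> A} = measure (distr M borel (X i)) A"
      using that by (subst measure_distr) (auto intro!: arg_cong[where f="measure M"])
    also have "\<dots> = measure lborel ({0..1} \<inter> A)"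
      using that unfolding eq by (subst measure_uniform_measure) auto
    finally show ?thesis .
  qed
  have "{0..1} \<inter> {..u} = {0..u}" "{0..1} \<inter> {..<u} = {0..<u}" "{0..1} \<inter> {u<..} = {u<..1}"
    using u by auto
  then show "measure M {\<omega> \<in> space M. X i \<omega> \<le> u} = u"
    and "measure M {\<omega> \<in> space M. X i \<omega> < u} = u"
    and "measure M {\<omega> \<in> space M. X i \<omega> > u} = 1 - u"
    using law[of "{..u}"] law[of "{..<u}"] law[of "{u<..}"] u by simp_all
  have "prob {\<omega> \<in> space M. X i \<omega> = u} = 0"
    using law[of "{u}"] u by simp
  then show "AE \<omega> in M. X i \<omega> \<noteq> u"
    by (subst (asm) prob_eq_0) auto
qed

text \<open>The sign \<open>\<alpha>\<^sub>i = -1\<close> turns \<open>\<alpha>\<^sub>i X\<^sub>i > \<alpha>\<^sub>i u\<close> into \<open>X\<^sub>i < u\<close>, which is almost surely \<open>X\<^sub>i \<le> u\<close>, and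
  the sign \<open>\<alpha>\<^sub>i = 1\<close> gives its negation \<open>X\<^sub>i > u\<close>. So the directional orthant is of the form
  treated by inclusion-exclusion, with one common family of events \<open>X\<^sub>i \<le> u\<close>.\<close>

lemma prob_orthant:
  assumes "prob_space M" and um: "uniform_marginals M d X" and u: "u \<in> {0..1}"
    and IJ: "I \<subseteq> {1..d}" "J = {1..d} - I"
    and neg: "\<forall>i\<in>I. \<alpha> i = -1" and pos: "\<forall>i\<in>J. \<alpha> i = 1"
  shows "measure M {\<omega> \<in> space M. \<forall>i\<in>{1..d}. \<alpha> i * X i \<omega> > \<alpha> i * u} =
    (\<Sum>S\<in>Pow J. (-1) ^ card S * measure M {\<omega> \<in> space M. \<forall>i\<in>I \<union> S. X i \<omega> \<le> u})"
proof -
  interpret prob_space M by fact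
  have [measurable]: "X i \<in> borel_measurable M" if "i \<in> {1..d}" for i
    using um that by (auto simp: uniform_marginals_def)
  have fin: "finite I" "finite J" and un: "{1..d} = I \<union> J"
    using IJ finite_subset by auto
  have [measurable]: "X i \<in> borel_measurable M" if "i \<in> I" for i using that un by simp
  have [measurable]: "X i \<in> borel_measurable M" if "i \<in> J" for i using that un by simp
  have \<alpha>: "\<alpha> i = (if i \<in> I then -1 else 1)" if "i \<in> I \<union> J" for i
    using that neg pos IJ by auto
  have "AE \<omega> in M. \<forall>i\<in>{1..d}. X i \<omega> \<noteq> u"
    using prob_uniform_marginal(4)[OF assms(1) um _ u] by (intro AE_finite_allI) auto
  then have "prob {\<omega> \<in> space M. \<forall>i\<in>{1..d}. \<alpha> i * X i \<omega> > \<alpha> i * u} =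
    prob {\<omega> \<in> space M. (\<forall>i\<in>I. X i \<omega> \<le> u) \<and> (\<forall>j\<in>J. \<not> X j \<omega> \<le> u)}"
  proof (intro finite_measure_eq_AE, eventually_elim)
    case (elim \<omega>)
    have "(\<alpha> i * X i \<omega> > \<alpha> i * u) = (if i \<in> I then X i \<omega> \<le> u else \<not> X i \<omega> \<le> u)"
      if "i \<in> I \<union> J" for i
      using that elim un \<alpha>[OF that] by (auto simp: order_less_le)
    then show ?case using IJ unfolding un by auto
  qed (use fin in measurable)
  also have "\<dots> = (\<Sum>S\<in>Pow J. (-1) ^ card S * prob {\<omega> \<in> space M. \<forall>i\<in>I \<union> S. X i \<omega> \<le> u})"
  proof (rule prob_inclusion_exclusion[OF fin])
    fix i assume "i \<in> I \<union> J"
    then have [measurable]: "X i \<in> borel_measurable M" using un by auto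
    show "{\<omega> \<in> space M. X i \<omega> \<le> u} \<in> events" by measurable
  qed
  finally show ?thesis .
qed

text \<open>The counterpart of \<open>prob_orthant\<close> for independent coordinates: expanding
  \<open>u\<^sup>|\<^sup>I\<^sup>| (1 - u)\<^sup>|\<^sup>J\<^sup>|\<close> over subsets of \<open>J\<close>, rather than by powers of \<open>u\<close>, matches the two
  expansions term by term.\<close>

lemma prod_marginals_orthant:
  assumes "prob_space M" and um: "uniform_marginals M d X" and u: "u \<in> {0..1}"
    and IJ: "I \<subseteq> {1..d}" "J = {1..d} - I"
    and neg: "\<forall>i\<in>I. \<alpha> i = -1" and pos: "\<forall>i\<in>J. \<alpha> i = 1"
  shows "(\<Prod>i=1..d. measure M {\<omega> \<in> space M. \<alpha> i * X i \<omega> > \<alpha> i * u}) =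
    (\<Sum>S\<in>Pow J. (-1) ^ card S * u ^ card (I \<union> S))"
proof -
  have fin: "finite I" "finite J" and un: "{1..d} = I \<union> J" and disj: "I \<inter> J = {}"
    using IJ finite_subset by auto
  have "(\<Prod>i=1..d. measure M {\<omega> \<in> space M. \<alpha> i * X i \<omega> > \<alpha> i * u}) =
    (\<Prod>i\<in>I. measure M {\<omega> \<in> space M. \<alpha> i * X i \<omega> > \<alpha> i * u}) *
    (\<Prod>i\<in>J. measure M {\<omega> \<in> space M. \<alpha> i * X i \<omega> > \<alpha> i * u})"
    unfolding un by (rule prod.union_disjoint[OF fin disj])
  also have "\<dots> = (\<Prod>i\<in>I. u) * (\<Prod>j\<in>J. 1 - u)"
  proof (intro arg_cong2[where f="(*)"] prod.cong refl)
    fix i assume i: "i \<in> I"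
    then show "measure M {\<omega> \<in> space M. \<alpha> i * X i \<omega> > \<alpha> i * u} = u"
      using prob_uniform_marginal(2)[OF assms(1) um _ u, of i] neg IJ by auto
  next
    fix i assume i: "i \<in> J"
    then show "measure M {\<omega> \<in> space M. \<alpha> i * X i \<omega> > \<alpha> i * u} = 1 - u"
      using prob_uniform_marginal(3)[OF assms(1) um _ u, of i] pos IJ by auto
  qed
  also have "\<dots> = u ^ card I * (\<Sum>S\<in>Pow J. (-1) ^ card S * u ^ card S)"
    by (simp only: prod_diff_conv_sum[OF \<open>finite J\<close>]) simp
  also have "\<dots> = (\<Sum>S\<in>Pow J. (-1) ^ card S * u ^ card (I \<union> S))"
    unfolding sum_distrib_left
  proof (intro sum.cong refl)
    fix S assume "S \<in> Pow J"
    then have "card (I \<union> S) = card I + card S"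
      using fin disj by (intro card_Un_disjoint) (auto intro: finite_subset)
    then show "u ^ card I * ((-1) ^ card S * u ^ card S) = (-1) ^ card S * u ^ card (I \<union> S)"
      by (simp add: power_add)
  qed
  finally show ?thesis .
qed

section \<open>Integrals along the diagonal\<close>

text \<open>The diagonal section is increasing in \<open>u\<close>, hence Borel, and bounded by \<open>1\<close>.\<close>

lemma set_integrable_diagonal:
  assumes "prob_space M" "finite K" and X: "\<And>i. i \<in> K \<Longrightarrow> X i \<in> borel_measurable M"
  shows "set_integrable lborel {0..1} (\<lambda>u::real. measure M {\<omega> \<in> space M. \<forall>i\<in>K. X i \<omega> \<le> u})"
proof -
  interpret prob_space M by fact
  note [measurable] = X \<open>finite K\<close>
  have "mono (\<lambda>u. prob {\<omega> \<in> space M. \<forall>i\<in>K. X i \<omega> \<le> u})"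
    by (intro monoI finite_measure_mono) (auto intro: order_trans)
  then have [measurable]: "(\<lambda>u. prob {\<omega> \<in> space M. \<forall>i\<in>K. X i \<omega> \<le> u}) \<in> borel_measurable borel"
    by (rule borel_measurable_mono)
  have "set_integrable lborel {0..1::real} (\<lambda>_. 1::real)"
    by (simp add: set_integrable_def)
  then show ?thesis
    by (rule set_integrable_bound) (auto simp: set_borel_measurable_def)
qed

lemma
  fixes k :: nat
  shows set_integrable_power: "set_integrable lborel {0..1} (\<lambda>u::real. u ^ k)"
    and set_integral_power: "(LBINT u:{0..1}. u ^ k) = 1 / (real k + 1)"
  using integral_power[of 0 1 k]
  by (auto simp: set_lebesgue_integral_def mult.commute add.commute
      intro!: borel_integrable_atLeastAtMost' continuous_intros)

text \<open>The downward index, freed of its normalisation, is the excess of the diagonal section over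
  that of independent coordinates. For \<open>card K \<le> 1\<close> there is no excess: the diagonal section is
  \<open>1\<close> for the empty set and \<open>u\<close> for a singleton.\<close>

lemma integral_diagonal_minus_power:
  assumes "prob_space M" and um: "uniform_marginals M d X" and K: "K \<subseteq> {1..d}"
  shows "(LBINT u:{0..1}. measure M {\<omega> \<in> space M. \<forall>i\<in>K. X i \<omega> \<le> u} - u ^ card K) =
    (if card K \<le> 1 then 0
     else (real (card K) - 1) / (2 * (real (card K) + 1)) * phi_minus M X K)"
proof (cases "card K \<le> 1")
  case True
  interpret prob_space M by fact
  have "measure M {\<omega> \<in> space M. \<forall>i\<in>K. X i \<omega> \<le> u} - u ^ card K = 0" if "u \<in> {0..1}" for u
  proof (cases "K = {}")
    case False
    with True K obtain i where i: "K = {i}"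
      by (metis card_0_eq card_1_singletonE finite_atLeastAtMost finite_subset le_neq_implies_less less_one)
    then show ?thesis using prob_uniform_marginal(1)[OF assms(1) um _ that, of i] K by simp
  qed (simp add: prob_space)
  then have "(LBINT u:{0..1}. measure M {\<omega> \<in> space M. \<forall>i\<in>K. X i \<omega> \<le> u} - u ^ card K) =
    (LBINT u:{0..1::real}. 0)"
    by (intro set_lebesgue_integral_cong) auto
  with True show ?thesis by simp
next
  case False
  define G where "G = (LBINT u:{0..1}. measure M {\<omega> \<in> space M. \<forall>i\<in>K. X i \<omega> \<le> u})"
  have "set_integrable lborel {0..1} (\<lambda>u. measure M {\<omega> \<in> space M. \<forall>i\<in>K. X i \<omega> \<le> u})"
    using assms by (intro set_integrable_diagonal) (auto simp: uniform_marginals_def intro: finite_subset)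
  then have "(LBINT u:{0..1}. measure M {\<omega> \<in> space M. \<forall>i\<in>K. X i \<omega> \<le> u} - u ^ card K) =
    G - 1 / (real (card K) + 1)"
    by (simp add: set_integrable_power set_integral_power G_def)
  also have "\<dots> = (real (card K) - 1) / (2 * (real (card K) + 1)) * phi_minus M X K"
  proof -
    \<comment> \<open>In terms of \<open>m\<close> both denominators, \<open>m\<close> and \<open>m + 2\<close>, are visibly positive.\<close>
    define m where "m = real (card K) - 1"
    have "m > 0" and k: "real (card K) = m + 1"
      using False by (auto simp: m_def)
    have phi: "phi_minus M X K = 2 * ((m + 2) * G - 1) / m"
      unfolding phi_minus_def G_def[symmetric] k by (simp add: diff_divide_distrib algebra_simps)
    have "G - 1 / (m + 2) = ((m + 2) * G - 1) / (m + 2)"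
      using \<open>m > 0\<close> by (simp add: field_simps)
    also have "\<dots> = m / (2 * (m + 2)) * (2 * ((m + 2) * G - 1) / m)"
    proof -
      have "x / c = m / (2 * c) * (2 * x / m)" for x c using \<open>m > 0\<close> by simp
      then show ?thesis .
    qed
    finally show ?thesis unfolding phi k by (simp add: add.assoc)
  qed
  finally show ?thesis using False by simp
qed

section \<open>The directional coefficient\<close>

text \<open>Transfers the coefficient from the law determined by the copula back to the original
  random vector, whose distribution is that law by \<open>copula_law_eq\<close>.\<close>

lemma dir_footrule_eq:
  assumes "prob_space M" and C: "has_copula M d X C"
  shows "dir_footrule d \<alpha> C = 2 * (real d + 1) / (real d - 1) *
    (LBINT u:{0..1}. measure M {\<omega> \<in> space M. \<forall>i\<in>{1..d}. \<alpha> i * X i \<omega> > \<alpha> i * u}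
      - (\<Prod>i=1..d. measure M {\<omega> \<in> space M. \<alpha> i * X i \<omega> > \<alpha> i * u}))"
proof -
  let ?N = "PiM {1..d} (\<lambda>_. borel :: real measure)"
  let ?T = "\<lambda>\<omega>. \<lambda>i\<in>{1..d}. X i \<omega>"
  have T: "?T \<in> M \<rightarrow>\<^sub>M ?N"
    using C by (intro measurable_restrict) (auto simp: has_copula_def uniform_marginals_def)
  have law: "measure (copula_law d C) {x \<in> space (copula_law d C). Q x} =
    measure M {\<omega> \<in> space M. Q (?T \<omega>)}" if "{x \<in> space ?N. Q x} \<in> sets ?N" for Q
  proof -
    have "?T -` {x \<in> space ?N. Q x} \<inter> space M = {\<omega> \<in> space M. Q (?T \<omega>)}"
      using measurable_space[OF T] by blast
    then show ?thesis
      unfolding copula_law_eq[OF assms] space_distr measure_distr[OF T that] by simp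
  qed
  have ev: "{x \<in> space ?N. \<alpha> i * x i > \<alpha> i * u} \<in> sets ?N" if "i \<in> {1..d}" for i u
    using that by (intro borel_measurable_less borel_measurable_times measurable_component_singleton) auto
  have joint: "measure (copula_law d C) {x \<in> space (copula_law d C). \<forall>i\<in>{1..d}. \<alpha> i * x i > \<alpha> i * u} =
    measure M {\<omega> \<in> space M. \<forall>i\<in>{1..d}. \<alpha> i * X i \<omega> > \<alpha> i * u}" for u
  proof -
    have "{x \<in> space ?N. \<forall>i\<in>{1..d}. \<alpha> i * x i > \<alpha> i * u} \<in> sets ?N"
      by (intro sets.sets_Collect_finite_All ev) auto
    from law[OF this] show ?thesis by (simp only: restrict_apply' cong: ball_cong)
  qed
  have marginal: "measure (copula_law d C) {x \<in> space (copula_law d C). \<alpha> i * x i > \<alpha> i * u} =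
    measure M {\<omega> \<in> space M. \<alpha> i * X i \<omega> > \<alpha> i * u}" if "i \<in> {1..d}" for i u
    using law[OF ev[OF that]] that by simp
  show ?thesis
    unfolding dir_footrule_def Let_def by (simp only: joint marginal cong: prod.cong)
qed

theorem theorem4:
  fixes M :: "'a measure" and X :: "nat \<Rightarrow> 'a \<Rightarrow> real" and C :: "(nat \<Rightarrow> real) \<Rightarrow> real"
    and d :: nat and \<alpha> :: "nat \<Rightarrow> real" and I J :: "nat set"
  assumes "prob_space M"
    and "d \<ge> 2"
    and "uniform_marginals M d X"
    and "has_copula M d X C"
    and "\<forall>i\<in>{1..d}. \<alpha> i \<in> {-1, 1}"
    and "I \<subseteq> {1..d}"
    and "J = {1..d} - I"
    and "\<forall>i\<in>I. \<alpha> i = -1"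
    and "\<forall>i\<in>J. \<alpha> i = 1"
  shows "dir_footrule d \<alpha> C =
    2 * (real d + 1) / (real d - 1) *
    (\<Sum>S\<in>Pow J. if card (I \<union> S) \<le> 1 then 0
       else (-1) ^ card S * ((real (card I) + real (card S) - 1) / (2 * (real (card I) + real (card S) + 1)))
              * phi_minus M X (I \<union> S))"
proof -
  let ?G = "\<lambda>K u. measure M {\<omega> \<in> space M. \<forall>i\<in>K. X i \<omega> \<le> u}"
  have sub: "I \<union> S \<subseteq> {1..d}" if "S \<in> Pow J" for S
    using that assms by auto
  have int: "set_integrable lborel {0..1} (\<lambda>u. ?G (I \<union> S) u - u ^ card (I \<union> S))" if "S \<in> Pow J" for S
    using sub[OF that] assms(1,3)
    by (intro set_integral_diff set_integrable_power set_integrable_diagonal)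
      (auto simp: uniform_marginals_def intro: finite_subset)
  have "(LBINT u:{0..1}. measure M {\<omega> \<in> space M. \<forall>i\<in>{1..d}. \<alpha> i * X i \<omega> > \<alpha> i * u}
      - (\<Prod>i=1..d. measure M {\<omega> \<in> space M. \<alpha> i * X i \<omega> > \<alpha> i * u})) =
    (LBINT u:{0..1}. \<Sum>S\<in>Pow J. (-1) ^ card S * (?G (I \<union> S) u - u ^ card (I \<union> S)))"
    using prob_orthant[OF assms(1,3) _ assms(6,7,8,9)] prod_marginals_orthant[OF assms(1,3) _ assms(6,7,8,9)]
    by (intro set_lebesgue_integral_cong) (auto simp: sum_subtractf right_diff_distrib)
  also have "\<dots> = (\<Sum>S\<in>Pow J. (-1) ^ card S * (LBINT u:{0..1}. ?G (I \<union> S) u - u ^ card (I \<union> S)))"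
    using int unfolding set_lebesgue_integral_def set_integrable_def
    by (simp add: sum_distrib_left mult.left_commute[of "indicator _ _"])
  also have "\<dots> = (\<Sum>S\<in>Pow J. if card (I \<union> S) \<le> 1 then 0
       else (-1) ^ card S * ((real (card I) + real (card S) - 1) / (2 * (real (card I) + real (card S) + 1)))
              * phi_minus M X (I \<union> S))"
  proof (intro sum.cong refl)
    fix S assume S: "S \<in> Pow J"
    have "card (I \<union> S) = card I + card S"
      using S assms(6,7) by (intro card_Un_disjoint) (auto intro: finite_subset)
    then show "(-1) ^ card S * (LBINT u:{0..1}. ?G (I \<union> S) u - u ^ card (I \<union> S)) =
      (if card (I \<union> S) \<le> 1 then 0
       else (-1) ^ card S * ((real (card I) + real (card S) - 1) / (2 * (real (card I) + real (card S) + 1)))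
              * phi_minus M X (I \<union> S))"
      unfolding integral_diagonal_minus_power[OF assms(1,3) sub[OF S]] by simp
  qed
  finally show ?thesis
    unfolding dir_footrule_eq[OF assms(1,4)] by simp
qed

end
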